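(* Let $S\subseteq2^E$ and $e\in E$. Then $S$ is powerful if and only if its parallel extension $S^{\parallel e}$ (formed by duplicating the column indexed by $e$ in the matrix representation of $S$) is powerful.
   Context: A set $S\subseteq\{0,1\}^E$ (equivalently $S\subseteq2^E$, identifying subsets with characteristic vectors) is powerful if for every $X\subseteq E$ the number of vectors in $S$ that are zero in all positions indexed by $X$ is a power of 2. The matrix representation of $S$ has the members of $S$ as rows and columns indexed by $E$. For $e\in E$, the parallel extension $S^{\parallel e}$ is the set obtained by adding a new element whose column is a copy of the column indexed by $e$. *)

theory Defs
  imports Main
begin

text \<open>
  A vector in $\{0,1\}^E$ is represented by its support, a subset of \<open>E\<close>; it is zero in all
  positions of \<open>X\<close> iff the support is disjoint from \<open>X\<close>. Since \<open>card\<close> of an infinite set is 0,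
  which is not a power of 2, an infinite family never counts as having a power of 2 of members.
\<close>

definition powerful :: "'a set \<Rightarrow> 'a set set \<Rightarrow> bool" where
  "powerful E S \<longleftrightarrow> (\<forall>X \<subseteq> E. \<exists>k::nat. card {A \<in> S. A \<inter> X = {}} = 2 ^ k)"

text \<open>
  The new element \<open>f\<close> is meant to lie outside the ground set: each row \<open>A\<close> gets an extra entry at
  \<open>f\<close> equal to its entry at \<open>e\<close>. The ground set of the extension is \<open>insert f E\<close>.
\<close>

definition parallel_extension :: "'a \<Rightarrow> 'a \<Rightarrow> 'a set set \<Rightarrow> 'a set set" where
  "parallel_extension e f S = (\<lambda>A. if e \<in> A then insert f A else A) ` S"

end

theory Submission
  imports Defs
begin

text \<open>The entries of an extended row at \<open>f\<close> and \<open>e\<close> agree, so it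
  vanishes on \<open>X\<close> iff the original row vanishes on \<open>X\<close> with
  \<open>f\<close> traded for \<open>e\<close>. As \<open>f\<close> is fresh, distinct rows stay
  distinct, and the two counts coincide (\<open>card_parallel_extension_avoiding\<close>). The trade
  maps subsets of \<open>insert f E\<close> onto subsets of \<open>E\<close>, so both families have
  the same counts to test.\<close>

lemma inj_on_parallel_row:
  assumes "S \<subseteq> Pow E" and "f \<notin> E"
  shows "inj_on (\<lambda>A. if e \<in> A then insert f A else A) S"
proof (rule inj_on_inverseI)
  fix A assume "A \<in> S"
  then have "f \<notin> A" using assms by auto
  then show "(if e \<in> A then insert f A else A) - {f} = A" by auto
qed

text \<open>Extending rows is a bijection between the two families counted. Because \<open>X\<close>
  is arbitrary, the equation can rewrite the count under the quantifier of
  \<open>powerful\<close>.\<close>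

lemma card_parallel_extension_avoiding:
  assumes "S \<subseteq> Pow E" and "f \<notin> E"
  shows "card {B \<in> parallel_extension e f S. B \<inter> X = {}} =
    card {A \<in> S. A \<inter> (if f \<in> X then insert e (X - {f}) else X) = {}}"
    (is "_ = card ?T")
proof -
  let ?g = "\<lambda>A. if e \<in> A then insert f A else A"
  have "?g A \<inter> X = {} \<longleftrightarrow> A \<inter> (if f \<in> X then insert e (X - {f}) else X) = {}"
    if "A \<in> S" for A
  proof -
    \<comment> \<open>Freshness makes \<open>f\<close> lie in the extended row exactly when
      \<open>e\<close> lies in \<open>A\<close>.\<close>
    have "f \<notin> A" using that assms by auto
    then show ?thesis by auto
  qed
  then have "{B \<in> parallel_extension e f S. B \<inter> X = {}} = ?g ` ?T"
    unfolding parallel_extension_def by blast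
  moreover have "inj_on ?g ?T"
    using inj_on_parallel_row[OF assms] by (rule inj_on_subset) auto
  ultimately show ?thesis by (simp only: card_image)
qed

theorem theorem7:
  fixes E :: "'a set" and S :: "'a set set" and e f :: 'a
  assumes "S \<subseteq> Pow E"
    and "e \<in> E"
    and "f \<notin> E"
  shows "powerful E S \<longleftrightarrow> powerful (insert f E) (parallel_extension e f S)"
proof
  assume S: "powerful E S"
  show "powerful (insert f E) (parallel_extension e f S)"
    unfolding powerful_def card_parallel_extension_avoiding[OF assms(1,3)]
  proof (intro allI impI)
    fix X assume "X \<subseteq> insert f E"
    \<comment> \<open>Here \<open>e \<in> E\<close> matters: the traded set must be a legitimate
      test set for \<open>S\<close>.\<close>
    then have "(if f \<in> X then insert e (X - {f}) else X) \<subseteq> E"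
      using assms(2) by auto
    then show "\<exists>k. card {A \<in> S. A \<inter> (if f \<in> X then insert e (X - {f}) else X) = {}} = 2 ^ k"
      using S unfolding powerful_def by blast
  qed
next
  assume P: "powerful (insert f E) (parallel_extension e f S)"
  show "powerful E S"
    unfolding powerful_def
  proof (intro allI impI)
    fix X assume "X \<subseteq> E"
    \<comment> \<open>Without \<open>f\<close> the trade fixes \<open>X\<close>, so \<open>X\<close>
      tests the extension with the same count.\<close>
    then have "f \<notin> X" and "X \<subseteq> insert f E" using assms(3) by auto
    then have "card {B \<in> parallel_extension e f S. B \<inter> X = {}} = card {A \<in> S. A \<inter> X = {}}"
      by (simp add: card_parallel_extension_avoiding[OF assms(1,3)])
    moreover have "\<exists>k. card {B \<in> parallel_extension e f S. B \<inter> X = {}} = 2 ^ k"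
      using P \<open>X \<subseteq> insert f E\<close> unfolding powerful_def by blast
    ultimately show "\<exists>k. card {A \<in> S. A \<inter> X = {}} = 2 ^ k"
      by (simp only:)
  qed
qed

end
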